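(* Let $T$ be a pre-Galois word, $p_o=\mathrm{Per}_o(T)$ and $p_e=\mathrm{Per}_e(T)$. For a symbol $z$, the word $T'=T\cdot z$ is pre-Galois if and only if both $T'[1..|T|-p_o+1]\preceq_{\mathrm{alt}}T'[p_o+1..|T|+1]$ and $T'[1..|T|-p_e+1]\preceq_{\mathrm{alt}}T'[p_e+1..|T|+1]$ hold.
   Context: $W[i..j]$ is the factor from position $i$ to $j$ (1-indexed), and is the empty word $\varepsilon$ if $i>j$. An integer $p\in[1..|W|]$ is a period of $W$ if $W[i+p]=W[i]$ for all $i\in[1..|W|-p]$. $\mathrm{Per}_o(W)$ (resp. $\mathrm{Per}_e(W)$) is the shortest odd (resp. even) period of $W$, and is set to $|W|+1$ if $W$ has no odd (resp. even) period. Alternating order: for words $S,T$ with $S^\omega\neq T^\omega$ ($X^\omega$ the infinite repetition of $X$), let $j$ be the first position with $S^\omega[j]\neq T^\omega[j]$; $S\prec_{\mathrm{alt}}T$ if $j$ is odd and $S^\omega[j]<T^\omega[j]$, or $j$ is even and $S^\omega[j]>T^\omega[j]$. $S=_{\mathrm{alt}}T$ if $S^\omega=T^\omega$; $\varepsilon\succ_{\mathrm{alt}}X$ for every nonempty $X$; $S\preceq_{\mathrm{alt}}T$ means $S\prec_{\mathrm{alt}}T$ or $S=_{\mathrm{alt}}T$. A word $T$ is pre-Galois if every proper suffix $S$ of $T$ is a prefix of $T$ or satisfies $S\succ_{\mathrm{alt}}T$. *)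

theory Defs
  imports Main "HOL-Library.Omega_Words_Fun" "HOL-Library.Sublist"
begin

text \<open>
  Words are lists over a linearly ordered alphabet. Positions are 1-indexed throughout, so the
  letter at position \<open>i\<close> of \<open>W\<close> is \<open>W ! (i - 1)\<close>, and position \<open>j\<close> of the infinite repetition
  \<open>S\<^sup>\<omega>\<close> is \<open>S\<^sup>\<omega> (j - 1)\<close>. The names \<open>prefix\<close> and \<open>suffix\<close> exist in both imported theories;
  the list versions are written with their theory qualifier.
\<close>

text \<open>
  For a period-like \<open>p \<le> n + 1\<close>, the factor \<open>W[1..n-p+1]\<close> has to be written with right end
  \<open>n + 1 - p\<close>: with truncated subtraction, \<open>n - p + 1\<close> would be 1 instead of 0 for \<open>p = n + 1\<close>.
\<close>

definition factor :: "'a list \<Rightarrow> nat \<Rightarrow> nat \<Rightarrow> 'a list"  (\<open>_\<lbrakk>_.._\<rbrakk>\<close> [1000, 0, 0] 1000)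
  where "W\<lbrakk>i..j\<rbrakk> = (if i > j then [] else map (\<lambda>k. W ! (k - 1)) [i..<Suc j])"

definition is_period :: "nat \<Rightarrow> 'a list \<Rightarrow> bool"
  where "is_period p W \<longleftrightarrow>
    p \<in> {1..length W} \<and> (\<forall>i\<in>{1..length W - p}. W ! (i + p - 1) = W ! (i - 1))"

definition Per_o :: "'a list \<Rightarrow> nat"
  where "Per_o W =
    (if \<exists>p. odd p \<and> is_period p W then LEAST p. odd p \<and> is_period p W else length W + 1)"

definition Per_e :: "'a list \<Rightarrow> nat"
  where "Per_e W =
    (if \<exists>p. even p \<and> is_period p W then LEAST p. even p \<and> is_period p W else length W + 1)"

text \<open>
  The library leaves \<open>[]\<^sup>\<omega>\<close> unspecified, so the empty word is treated separately: it is greater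
  than every nonempty word and equivalent only to itself.
\<close>

definition alt_less :: "'a::linorder list \<Rightarrow> 'a list \<Rightarrow> bool"  (infix \<open>\<prec>\<^sub>a\<^sub>l\<^sub>t\<close> 50)
  where "S \<prec>\<^sub>a\<^sub>l\<^sub>t T \<longleftrightarrow>
    S \<noteq> [] \<and>
    (T = [] \<or>
     (\<exists>j\<ge>1. (\<forall>i\<in>{1..<j}. S\<^sup>\<omega> (i - 1) = T\<^sup>\<omega> (i - 1)) \<and>
            (odd j \<and> S\<^sup>\<omega> (j - 1) < T\<^sup>\<omega> (j - 1) \<or>
             even j \<and> S\<^sup>\<omega> (j - 1) > T\<^sup>\<omega> (j - 1))))"

definition alt_eq :: "'a list \<Rightarrow> 'a list \<Rightarrow> bool"  (infix \<open>=\<^sub>a\<^sub>l\<^sub>t\<close> 50)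
  where "S =\<^sub>a\<^sub>l\<^sub>t T \<longleftrightarrow> (S = [] \<longleftrightarrow> T = []) \<and> S\<^sup>\<omega> = T\<^sup>\<omega>"

definition alt_le :: "'a::linorder list \<Rightarrow> 'a list \<Rightarrow> bool"  (infix \<open>\<preceq>\<^sub>a\<^sub>l\<^sub>t\<close> 50)
  where "S \<preceq>\<^sub>a\<^sub>l\<^sub>t T \<longleftrightarrow> S \<prec>\<^sub>a\<^sub>l\<^sub>t T \<or> S =\<^sub>a\<^sub>l\<^sub>t T"

definition pre_Galois :: "'a::linorder list \<Rightarrow> bool"
  where "pre_Galois T \<longleftrightarrow> (\<forall>S. strict_suffix S T \<longrightarrow> Sublist.prefix S T \<or> T \<prec>\<^sub>a\<^sub>l\<^sub>t S)"

end

theory Submission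
  imports Defs
begin

text \<open>
  Let \<open>n = length T\<close>. If the words \<open>T\<close> and \<open>drop p T\<close> differ at all within the length of the latter, the first
  difference decides their alternating order; so \<open>T\<close> is pre-Galois iff every such first difference
  goes the right way. Appending \<open>z\<close> creates new first differences only for those \<open>p\<close> that are periods
  of \<open>T\<close>, where \<open>z\<close> is compared with the letter \<open>T[n-p+1]\<close>. If \<open>q < p\<close> are two periods of the same
  parity, then \<open>T\<close> and \<open>drop (p - q) T\<close> agree on their first \<open>n - p\<close> letters and next have
  \<open>T[n-p+1]\<close> and \<open>T[n-q+1]\<close>, which are thus ordered because \<open>T\<close> is pre-Galois. Hence the condition
  for \<open>p\<close> follows from the one for \<open>q\<close>, and only the shortest period of each parity matters.
\<close>

text \<open>The comparison that the alternating order uses at the 0-based position \<open>k\<close>.\<close>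

definition letter_le :: "nat \<Rightarrow> 'a::linorder \<Rightarrow> 'a \<Rightarrow> bool"
  where "letter_le k a b \<longleftrightarrow> (if even k then a \<le> b else b \<le> a)"

lemma letter_le_refl [simp]: "letter_le k a a"
  by (simp add: letter_le_def)

lemma letter_le_trans: "letter_le k a b \<Longrightarrow> letter_le k b c \<Longrightarrow> letter_le k a c"
  by (auto simp: letter_le_def split: if_splits)

lemma letter_le_cong_parity: "even k = even l \<Longrightarrow> letter_le k = letter_le l"
  by (simp add: letter_le_def fun_eq_iff)

section \<open>First differences in the alternating order\<close>

lemma iter_nth: "i < length W \<Longrightarrow> W\<^sup>\<omega> i = W ! i"
  by (auto simp: iter_def)

text \<open>An infinite repetition starts with the word itself, so a first difference inside both
  words is also the first difference of the repetitions. The 0-based \<open>k\<close> is the 1-based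
  position \<open>Suc k\<close>, hence odd positions correspond to even \<open>k\<close>; as the two
  letters differ, the non-strict \<open>letter_le\<close> amounts to strict comparison.\<close>

lemma alt_less_iff_first_diff:
  fixes U V :: "'a::linorder list"
  assumes k: "k < length U" "k < length V"
    and agree: "\<forall>i<k. U ! i = V ! i" and diff: "U ! k \<noteq> V ! k"
  shows "U \<prec>\<^sub>a\<^sub>l\<^sub>t V \<longleftrightarrow> letter_le k (U ! k) (V ! k)"
proof -
  have nonempty: "U \<noteq> []" "V \<noteq> []"
    using k by auto
  have agree': "U\<^sup>\<omega> i = V\<^sup>\<omega> i" if "i < k" for i
    using that k agree by (simp add: iter_nth)
  have at_k: "U\<^sup>\<omega> k = U ! k" "V\<^sup>\<omega> k = V ! k"
    using k by (simp_all add: iter_nth)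
  show ?thesis
  proof
    assume "U \<prec>\<^sub>a\<^sub>l\<^sub>t V"
    then obtain j where j: "j \<ge> 1" "\<forall>i\<in>{1..<j}. U\<^sup>\<omega> (i - 1) = V\<^sup>\<omega> (i - 1)"
      "odd j \<and> U\<^sup>\<omega> (j - 1) < V\<^sup>\<omega> (j - 1) \<or> even j \<and> U\<^sup>\<omega> (j - 1) > V\<^sup>\<omega> (j - 1)"
      using nonempty unfolding alt_less_def by blast
    \<comment> \<open>The position \<open>j\<close> witnessing the order can be neither before the
      difference at \<open>k\<close> nor after it.\<close>
    have "\<not> j - 1 < k"
      using agree'[of "j - 1"] j(3) by auto
    moreover have "\<not> Suc k < j"
      using j(2)[rule_format, of "Suc k"] at_k diff by auto
    ultimately have "j = Suc k"
      using j(1) by linarith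
    then show "letter_le k (U ! k) (V ! k)"
      using j(3) at_k by (auto simp: letter_le_def)
  next
    assume "letter_le k (U ! k) (V ! k)"
    moreover have "\<forall>i\<in>{1..<Suc k}. U\<^sup>\<omega> (i - 1) = V\<^sup>\<omega> (i - 1)"
      using agree' by auto
    ultimately show "U \<prec>\<^sub>a\<^sub>l\<^sub>t V"
      unfolding alt_less_def using nonempty at_k diff
      by (auto simp: letter_le_def split: if_splits intro!: exI[of _ "Suc k"])
  qed
qed

lemma prefix_iff_nth:
  "Sublist.prefix S T \<longleftrightarrow> length S \<le> length T \<and> (\<forall>i<length S. S ! i = T ! i)"
proof
  assume "Sublist.prefix S T"
  then show "length S \<le> length T \<and> (\<forall>i<length S. S ! i = T ! i)"
    by (auto elim!: Sublist.prefixE simp: nth_append)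
next
  assume "length S \<le> length T \<and> (\<forall>i<length S. S ! i = T ! i)"
  then have "S = take (length S) T"
    by (auto intro!: nth_equalityI)
  then show "Sublist.prefix S T"
    by (metis take_is_prefix)
qed

lemma strict_suffix_iff_drop:
  "strict_suffix S T \<longleftrightarrow> (\<exists>p. 0 < p \<and> p \<le> length T \<and> S = drop p T)"
proof
  assume "strict_suffix S T"
  then obtain U where "T = U @ S" "U \<noteq> []"
    by (auto simp: strict_suffix_def suffix_def)
  then show "\<exists>p. 0 < p \<and> p \<le> length T \<and> S = drop p T"
    by (intro exI[of _ "length U"]) auto
next
  assume "\<exists>p. 0 < p \<and> p \<le> length T \<and> S = drop p T"
  then obtain p where p: "0 < p" "p \<le> length T" "S = drop p T"
    by blast
  then have "length S \<noteq> length T"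
    by auto
  then have "S \<noteq> T"
    by blast
  then show "strict_suffix S T"
    using p suffix_drop[of p T] by (simp add: strict_suffix_def)
qed

text \<open>This removes infinite words from the argument. The suffix \<open>drop p T\<close> is a
  prefix exactly when no difference occurs inside it; otherwise the first difference decides. Equal
  letters and \<open>p = 0\<close> give only reflexive instances of
  \<open>letter_le\<close>.\<close>

lemma pre_Galois_iff:
  fixes T :: "'a::linorder list"
  shows "pre_Galois T \<longleftrightarrow>
    (\<forall>p k. p + k < length T \<longrightarrow> (\<forall>i<k. T ! (p + i) = T ! i) \<longrightarrow> letter_le k (T ! k) (T ! (p + k)))"
proof
  assume T: "pre_Galois T"
  show "\<forall>p k. p + k < length T \<longrightarrow> (\<forall>i<k. T ! (p + i) = T ! i) \<longrightarrow>
    letter_le k (T ! k) (T ! (p + k))"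
  proof (intro allI impI)
    fix p k
    assume pk: "p + k < length T" and agree: "\<forall>i<k. T ! (p + i) = T ! i"
    show "letter_le k (T ! k) (T ! (p + k))"
    proof (cases "T ! k = T ! (p + k)")
      case False
      then have "0 < p"
        by (cases p) auto
      then have "strict_suffix (drop p T) T"
        using pk by (auto simp: strict_suffix_iff_drop intro!: exI[of _ p])
      moreover have "\<not> Sublist.prefix (drop p T) T"
        using False pk unfolding prefix_iff_nth
        by (metis add.commute add_leD1 length_drop less_diff_conv less_imp_le_nat nth_drop)
      ultimately have "T \<prec>\<^sub>a\<^sub>l\<^sub>t drop p T"
        using T unfolding pre_Galois_def by blast
      then show ?thesis
        using alt_less_iff_first_diff[of k T "drop p T"] pk agree False by auto
    qed simp
  qed
next
  assume R: "\<forall>p k. p + k < length T \<longrightarrow> (\<forall>i<k. T ! (p + i) = T ! i) \<longrightarrow>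
    letter_le k (T ! k) (T ! (p + k))"
  show "pre_Galois T"
    unfolding pre_Galois_def
  proof (intro allI impI)
    fix S
    assume "strict_suffix S T"
    then obtain p where p: "p \<le> length T" "S = drop p T"
      by (auto simp: strict_suffix_iff_drop)
    show "Sublist.prefix S T \<or> T \<prec>\<^sub>a\<^sub>l\<^sub>t S"
    proof (cases "Sublist.prefix S T")
      case False
      then have ex: "\<exists>k. p + k < length T \<and> T ! k \<noteq> T ! (p + k)"
        using p by (auto simp: prefix_iff_nth less_diff_conv add.commute)
      obtain k where k: "p + k < length T" "T ! k \<noteq> T ! (p + k)"
        and least: "\<forall>i<k. \<not> (p + i < length T \<and> T ! i \<noteq> T ! (p + i))"
        using ex[unfolded exists_least_iff[of "\<lambda>k. p + k < length T \<and> T ! k \<noteq> T ! (p + k)"]]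
        by blast
      have agree: "T ! (p + i) = T ! i" if "i < k" for i
        using least[rule_format, OF that] k(1) that by simp
      then have "letter_le k (T ! k) (T ! (p + k))"
        using R k by blast
      then show ?thesis
        using alt_less_iff_first_diff[of k T S] p k agree by simp
    qed simp
  qed
qed

section \<open>Appending a letter and the periods of the word\<close>

lemma is_period_iff_nth:
  "is_period p W \<longleftrightarrow> 0 < p \<and> p \<le> length W \<and> (\<forall>i. p + i < length W \<longrightarrow> W ! (p + i) = W ! i)"
proof
  assume L: "is_period p W"
  have "W ! (p + i) = W ! i" if "p + i < length W" for i
  proof -
    have "Suc i \<in> {1..length W - p}"
      using that by auto
    then have "W ! (Suc i + p - 1) = W ! (Suc i - 1)"
      using L unfolding is_period_def by blast
    then show ?thesis
      by (simp add: add.commute)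
  qed
  then show "0 < p \<and> p \<le> length W \<and> (\<forall>i. p + i < length W \<longrightarrow> W ! (p + i) = W ! i)"
    using L by (auto simp: is_period_def)
next
  assume R: "0 < p \<and> p \<le> length W \<and> (\<forall>i. p + i < length W \<longrightarrow> W ! (p + i) = W ! i)"
  have "W ! (i + p - 1) = W ! (i - 1)" if "i \<in> {1..length W - p}" for i
  proof -
    have "p + (i - 1) < length W" "i + p - 1 = p + (i - 1)"
      using that by auto
    then show ?thesis
      using R by simp
  qed
  then show "is_period p W"
    using R by (auto simp: is_period_def)
qed

text \<open>A comparison that ends inside \<open>T\<close> is settled by \<open>T\<close> being
  pre-Galois. A new one has \<open>p + k = length T\<close>, so it reaches \<open>z\<close>, and
  agreement before \<open>k\<close> then says that \<open>p\<close> is a period.\<close>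

lemma pre_Galois_snoc_iff:
  fixes T :: "'a::linorder list"
  assumes T: "pre_Galois T"
  shows "pre_Galois (T @ [z]) \<longleftrightarrow>
    (\<forall>p. is_period p T \<longrightarrow> letter_le (length T - p) (T ! (length T - p)) z)"
proof
  assume L: "pre_Galois (T @ [z])"
  show "\<forall>p. is_period p T \<longrightarrow> letter_le (length T - p) (T ! (length T - p)) z"
  proof (intro allI impI)
    fix p
    assume "is_period p T"
    then have p: "0 < p" "p \<le> length T" and "\<And>i. p + i < length T \<Longrightarrow> T ! (p + i) = T ! i"
      unfolding is_period_iff_nth by blast+
    then have "(T @ [z]) ! (p + i) = (T @ [z]) ! i" if "i < length T - p" for i
      using that by (simp add: nth_append less_diff_conv add.commute)
    then have "letter_le (length T - p)
        ((T @ [z]) ! (length T - p)) ((T @ [z]) ! (p + (length T - p)))"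
      using p(2) by (intro L[unfolded pre_Galois_iff, rule_format]) simp_all
    moreover have "length T - p < length T"
      using p by linarith
    ultimately show "letter_le (length T - p) (T ! (length T - p)) z"
      using p by (simp add: nth_append_left)
  qed
next
  assume R: "\<forall>p. is_period p T \<longrightarrow> letter_le (length T - p) (T ! (length T - p)) z"
  show "pre_Galois (T @ [z])"
    unfolding pre_Galois_iff
  proof (intro allI impI)
    fix p k
    assume pk: "p + k < length (T @ [z])"
      and agree: "\<forall>i<k. (T @ [z]) ! (p + i) = (T @ [z]) ! i"
    show "letter_le k ((T @ [z]) ! k) ((T @ [z]) ! (p + k))"
    proof (cases "p = 0")
      case False
      have agree': "\<forall>i<k. T ! (p + i) = T ! i"
        using agree pk by (auto simp: nth_append)
      show ?thesis
      proof (cases "p + k < length T")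
        case True
        then show ?thesis
          using T agree' by (auto simp: pre_Galois_iff nth_append)
      next
        case last: False
        then have k: "k = length T - p" "p \<le> length T"
          using pk by auto
        then have "is_period p T"
          using False agree' by (auto simp: is_period_iff_nth)
        then show ?thesis
          using R k False by (auto simp: nth_append)
      qed
    qed simp
  qed
qed

lemma letter_le_of_shorter_period:
  fixes T :: "'a::linorder list"
  assumes T: "pre_Galois T" and p: "is_period p T" and q: "is_period q T"
    and "q \<le> p" "even p = even q"
    and le: "letter_le (length T - q) (T ! (length T - q)) z"
  shows "letter_le (length T - p) (T ! (length T - p)) z"
proof -
  let ?n = "length T"
  have bounds: "0 < q" "p \<le> ?n" "q \<le> ?n"
    using p q by (auto simp: is_period_iff_nth)
  \<comment> \<open>Shift \<open>i\<close> forward by the period \<open>p\<close>, then back by the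
    period \<open>q\<close>.\<close>
  have agree: "\<forall>i<?n - p. T ! (p - q + i) = T ! i"
  proof (intro allI impI)
    fix i
    assume i: "i < ?n - p"
    have "T ! i = T ! (p + i)"
      using p i unfolding is_period_iff_nth by simp
    also have "\<dots> = T ! (q + (p - q + i))"
      using \<open>q \<le> p\<close> by simp
    also have "\<dots> = T ! (p - q + i)"
      using q i \<open>q \<le> p\<close> unfolding is_period_iff_nth
      by (metis add.assoc add.commute le_add_diff_inverse less_diff_conv)
    finally show "T ! (p - q + i) = T ! i" ..
  qed
  have "p - q + (?n - p) = ?n - q"
    using bounds \<open>q \<le> p\<close> by simp
  then have "letter_le (?n - p) (T ! (?n - p)) (T ! (?n - q))"
    using T[unfolded pre_Galois_iff, rule_format, of "p - q" "?n - p"] agree bounds by simp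
  \<comment> \<open>Equal parity makes \<open>letter_le\<close> the same relation at both positions,
    so the two comparisons can be chained.\<close>
  moreover have "even (?n - p) = even (?n - q)"
    using bounds \<open>even p = even q\<close> by auto
  ultimately show ?thesis
    using le letter_le_trans letter_le_cong_parity by metis
qed

section \<open>The factor conditions in terms of single letters\<close>

lemma factor_eq_take: "j \<le> length W \<Longrightarrow> W\<lbrakk>1..j\<rbrakk> = take j W"
  by (auto simp: factor_def intro!: nth_equalityI simp del: upt_Suc)

lemma factor_eq_drop: "W\<lbrakk>Suc p..length W\<rbrakk> = drop p W"
  by (auto simp: factor_def intro!: nth_equalityI simp del: upt_Suc)

text \<open>Both factors have length \<open>length T - p + 1\<close> and, since \<open>p\<close> is
  a period, can differ only in their last letters.\<close>

lemma factor_condition_iff: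
  fixes T :: "'a::linorder list"
  assumes "is_period p T"
  shows "(T @ [z])\<lbrakk>1..length T + 1 - p\<rbrakk> \<preceq>\<^sub>a\<^sub>l\<^sub>t (T @ [z])\<lbrakk>p + 1..length T + 1\<rbrakk> \<longleftrightarrow>
    letter_le (length T - p) (T ! (length T - p)) z"
proof -
  let ?k = "length T - p"
  define U where "U = take (length T + 1 - p) (T @ [z])"
  define V where "V = drop p (T @ [z])"
  have p: "0 < p" "p \<le> length T"
    and period: "\<And>i. p + i < length T \<Longrightarrow> T ! (p + i) = T ! i"
    using assms unfolding is_period_iff_nth by blast+
  have len: "length U = Suc ?k" "length V = Suc ?k"
    using p by (auto simp: U_def V_def)
  have agree: "\<forall>i<?k. U ! i = V ! i"
    using p period by (simp add: U_def V_def nth_append)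
  have last: "U ! ?k = T ! ?k" "V ! ?k = z"
    using p by (auto simp: U_def V_def nth_append)
  have factors: "(T @ [z])\<lbrakk>1..length T + 1 - p\<rbrakk> = U" "(T @ [z])\<lbrakk>p + 1..length T + 1\<rbrakk> = V"
    using p factor_eq_take[of "length T + 1 - p" "T @ [z]"] factor_eq_drop[of "T @ [z]" p]
    by (simp_all add: U_def V_def)
  have "U \<preceq>\<^sub>a\<^sub>l\<^sub>t V \<longleftrightarrow> letter_le ?k (T ! ?k) z"
  proof (cases "T ! ?k = z")
    case True
    then have "U = V"
      using len agree last by (auto intro!: nth_equalityI simp: less_Suc_eq)
    then show ?thesis
      using True by (simp add: alt_le_def alt_eq_def)
  next
    case False
    \<comment> \<open>This excludes \<open>=\<^sub>a\<^sub>l\<^sub>t\<close>, leaving only the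
      strict order.\<close>
    then have "U\<^sup>\<omega> ?k \<noteq> V\<^sup>\<omega> ?k"
      using len last by (simp add: iter_nth)
    then have "U\<^sup>\<omega> \<noteq> V\<^sup>\<omega>"
      by metis
    then show ?thesis
      using alt_less_iff_first_diff[of ?k U V] len agree last False
      by (auto simp: alt_le_def alt_eq_def)
  qed
  then show ?thesis
    by (simp only: factors)
qed

text \<open>For the default value \<open>n + 1\<close> of a missing period both factors are empty,
  hence equivalent.\<close>

lemma factor_condition_no_period:
  "W\<lbrakk>1..n + 1 - (n + 1)\<rbrakk> \<preceq>\<^sub>a\<^sub>l\<^sub>t W\<lbrakk>n + 1 + 1..n + 1\<rbrakk>"
  by (simp add: factor_def alt_le_def alt_eq_def)

lemma Per_o_cases:
  obtains (no_period) "Per_o W = length W + 1" "\<And>p. is_period p W \<Longrightarrow> even p"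
  | (period) "is_period (Per_o W) W" "odd (Per_o W)" "\<And>p. is_period p W \<Longrightarrow> odd p \<Longrightarrow> Per_o W \<le> p"
proof (cases "\<exists>p. odd p \<and> is_period p W")
  case True
  then have "Per_o W = (LEAST p. odd p \<and> is_period p W)"
    unfolding Per_o_def by (rule if_P)
  then show ?thesis
    using period LeastI_ex[OF True] Least_le[of "\<lambda>p. odd p \<and> is_period p W"] by metis
next
  case False
  then show ?thesis
    by (intro no_period) (auto simp: Per_o_def)
qed

lemma Per_e_cases:
  obtains (no_period) "Per_e W = length W + 1" "\<And>p. is_period p W \<Longrightarrow> odd p"
  | (period) "is_period (Per_e W) W" "even (Per_e W)" "\<And>p. is_period p W \<Longrightarrow> even p \<Longrightarrow> Per_e W \<le> p"
proof (cases "\<exists>p. even p \<and> is_period p W")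
  case True
  then have "Per_e W = (LEAST p. even p \<and> is_period p W)"
    unfolding Per_e_def by (rule if_P)
  then show ?thesis
    using period LeastI_ex[OF True] Least_le[of "\<lambda>p. even p \<and> is_period p W"] by metis
next
  case False
  then show ?thesis
    by (intro no_period) (auto simp: Per_e_def)
qed

theorem theorem18:
  fixes T T' :: "'a::linorder list" and z :: 'a and p\<^sub>o p\<^sub>e :: nat
  assumes "pre_Galois T"
    and "p\<^sub>o = Per_o T"
    and "p\<^sub>e = Per_e T"
    and "T' = T @ [z]"
  shows "pre_Galois T' \<longleftrightarrow>
    T'\<lbrakk>1..length T + 1 - p\<^sub>o\<rbrakk> \<preceq>\<^sub>a\<^sub>l\<^sub>t T'\<lbrakk>p\<^sub>o + 1..length T + 1\<rbrakk> \<and>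
    T'\<lbrakk>1..length T + 1 - p\<^sub>e\<rbrakk> \<preceq>\<^sub>a\<^sub>l\<^sub>t T'\<lbrakk>p\<^sub>e + 1..length T + 1\<rbrakk>"
proof -
  let ?le = "\<lambda>p. letter_le (length T - p) (T ! (length T - p)) z"
  let ?cond = "\<lambda>p. T'\<lbrakk>1..length T + 1 - p\<rbrakk> \<preceq>\<^sub>a\<^sub>l\<^sub>t T'\<lbrakk>p + 1..length T + 1\<rbrakk>"
  have cond_iff: "?cond p \<longleftrightarrow> ?le p" if "is_period p T" for p
    using factor_condition_iff[OF that] assms(4) by simp
  have cond_none: "?cond (length T + 1)"
    by (rule factor_condition_no_period)
  have shorter: "?le p" if "is_period p T" "is_period q T" "q \<le> p" "even p = even q" "?le q" for p q
    using letter_le_of_shorter_period[OF assms(1) that] .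
  \<comment> \<open>The single condition at \<open>p\<^sub>o\<close> stands for all odd periods: it
    propagates upwards from the shortest one, and without odd periods both sides are true.\<close>
  have odd_periods: "?cond p\<^sub>o \<longleftrightarrow> (\<forall>p. is_period p T \<longrightarrow> odd p \<longrightarrow> ?le p)"
  proof (cases T rule: Per_o_cases)
    case no_period
    show ?thesis
      unfolding assms(2) no_period(1) using cond_none no_period(2) by blast
  next
    case period
    show ?thesis
      unfolding assms(2) cond_iff[OF period(1)]
      using period(1,2) shorter[OF _ period(1) period(3)] by blast
  qed
  have even_periods: "?cond p\<^sub>e \<longleftrightarrow> (\<forall>p. is_period p T \<longrightarrow> even p \<longrightarrow> ?le p)"
  proof (cases T rule: Per_e_cases)
    case no_period
    show ?thesis
      unfolding assms(3) no_period(1) using cond_none no_period(2) by blast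
  next
    case period
    show ?thesis
      unfolding assms(3) cond_iff[OF period(1)]
      using period(1,2) shorter[OF _ period(1) period(3)] by blast
  qed
  \<comment> \<open>Every period is odd or even, so the two families together give the criterion for
    appending \<open>z\<close>.\<close>
  show ?thesis
    using odd_periods even_periods pre_Galois_snoc_iff[OF assms(1), of z] assms(4) by blast
qed

end
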